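(* Let $S\subseteq\mathbb{Z}_2^n$ be a Sidon set with $0\notin S$ that generates $\mathbb{Z}_2^n$, and suppose that $Q_S$ admits a unitary signing. Then $Q_S$ has precisely $2^{|S|-n}$ switching-equivalence classes of unitary signings.
   Context: For $S\subseteq\mathbb{Z}_2^n$ with $0\notin S$, $Q_S$ is the (loopless, simple) graph with vertex set $\mathbb{Z}_2^n$ in which $x,y$ are adjacent iff $x+y\in S$. $S$ is a Sidon set if for all $a,b,c,d\in S$ with $a\ne b$, $c\neq d$ and $a+b=c+d$ one has $\{a,b\}=\{c,d\}$. A complex signing of a graph $G$ assigns to each ordered pair $(x,y)$ of adjacent vertices a value $\sigma(xy)\in\{1,-1,i,-i\}$ such that $\sigma(yx)=\overline{\sigma(xy)}$. Its adjacency matrix $M$ ($M_{xy}=\sigma(xy)$ for adjacent $x,y$, and $0$ otherwise) is Hermitian. For a $d$-regular graph the signing is unitary if $M^2=dI$. Switching: for a vertex $v$ and $a\in\{1,-1,i,-i\}$, $(a)$-switching at $v$ replaces $\sigma(uv)$ by $a\,\sigma(uv)$ and $\sigma(vu)$ by $\overline{a}\,\sigma(vu)$ for every neighbour $u$ of $v$, leaving all other values unchanged. Two complex signings of the same graph are switching equivalent if one is obtained from the other by a sequence of switchings. *)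

theory Defs
  imports
    "HOL-Analysis.Analysis"
    "HOL-Library.Z2"
    "HOL-Computational_Algebra.Group_Closure"
begin

instance bit :: finite
proof
  have "(UNIV :: bit set) \<subseteq> {0, 1}"
    by (auto intro: bit.exhaust)
  then show "finite (UNIV :: bit set)"
    by (rule finite_subset) simp
qed

text \<open>A graph on a finite vertex type is given by its adjacency relation.\<close>

type_synonym 'v graph = "'v \<Rightarrow> 'v \<Rightarrow> bool"

definition cayley_graph :: "(bit ^ 'n) set \<Rightarrow> (bit ^ 'n) graph" where
  "cayley_graph S x y \<longleftrightarrow> x + y \<in> S"

definition sidon_set :: "'a :: ab_semigroup_add set \<Rightarrow> bool" where
  "sidon_set S \<longleftrightarrow>
     (\<forall>a\<in>S. \<forall>b\<in>S. \<forall>c\<in>S. \<forall>d\<in>S.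
        a \<noteq> b \<longrightarrow> c \<noteq> d \<longrightarrow> a + b = c + d \<longrightarrow> {a, b} = {c, d})"

definition regular_graph :: "nat \<Rightarrow> 'v graph \<Rightarrow> bool" where
  "regular_graph d G \<longleftrightarrow> (\<forall>x. card {y. G x y} = d)"

definition signing_values :: "complex set" where
  "signing_values = {1, -1, \<i>, -\<i>}"

text \<open>
  A signing is a function on the ordered pairs of adjacent vertices. It is represented by its
  extension by \<open>0\<close> to all pairs, so that two signings are equal iff they agree on all adjacent
  pairs, and signings can be counted.
\<close>

type_synonym 'v signing = "'v \<Rightarrow> 'v \<Rightarrow> complex"

definition complex_signing :: "'v graph \<Rightarrow> 'v signing \<Rightarrow> bool" where
  "complex_signing G \<sigma> \<longleftrightarrow>
     (\<forall>x y. G x y \<longrightarrow> \<sigma> x y \<in> signing_values \<and> \<sigma> y x = cnj (\<sigma> x y)) \<and>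
     (\<forall>x y. \<not> G x y \<longrightarrow> \<sigma> x y = 0)"

definition signed_adjacency_matrix :: "'v signing \<Rightarrow> complex ^ ('v :: finite) ^ 'v" where
  "signed_adjacency_matrix \<sigma> = (\<chi> x y. \<sigma> x y)"

definition unitary_signing :: "('v :: finite) graph \<Rightarrow> 'v signing \<Rightarrow> bool" where
  "unitary_signing G \<sigma> \<longleftrightarrow>
     complex_signing G \<sigma> \<and>
     (\<exists>d. regular_graph d G \<and>
          signed_adjacency_matrix \<sigma> ** signed_adjacency_matrix \<sigma> = mat (of_nat d))"

text \<open>
  The \<open>(a)\<close>-switching at \<open>v\<close>. Non-adjacent pairs need no separate treatment, as the
  value \<open>0\<close> is unaffected; since the graphs are loopless, neither does the pair \<open>(v, v)\<close>.
\<close>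

definition switch_at :: "'v \<Rightarrow> complex \<Rightarrow> 'v signing \<Rightarrow> 'v signing" where
  "switch_at v a \<sigma> =
     (\<lambda>x y. if y = v then a * \<sigma> x y
            else if x = v then cnj a * \<sigma> x y
            else \<sigma> x y)"

definition switching_step :: "'v signing \<Rightarrow> 'v signing \<Rightarrow> bool" where
  "switching_step \<sigma> \<tau> \<longleftrightarrow> (\<exists>v. \<exists>a\<in>signing_values. \<tau> = switch_at v a \<sigma>)"

definition switching_equivalent :: "'v signing \<Rightarrow> 'v signing \<Rightarrow> bool" where
  "switching_equivalent = switching_step\<^sup>*\<^sup>*"

definition unitary_signings :: "('v :: finite) graph \<Rightarrow> 'v signing set" where
  "unitary_signings G = {\<sigma>. unitary_signing G \<sigma>}"

definition switching_relation :: "('v :: finite) graph \<Rightarrow> ('v signing \<times> 'v signing) set" where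
  "switching_relation G =
     {(\<sigma>, \<tau>). \<sigma> \<in> unitary_signings G \<and> \<tau> \<in> unitary_signings G \<and> switching_equivalent \<sigma> \<tau>}"

lemma switching_equivalent_sym:
  assumes "switching_equivalent \<sigma> \<tau>"
  shows "switching_equivalent \<tau> \<sigma>"
proof -
  have "switching_step \<tau>' \<sigma>'" if "switching_step \<sigma>' \<tau>'" for \<sigma>' \<tau>' :: "'a signing"
  proof -
    from that obtain v a where a: "a \<in> signing_values" and \<tau>': "\<tau>' = switch_at v a \<sigma>'"
      by (auto simp: switching_step_def)
    have "cnj a * a = 1" "a * cnj a = 1"
      using a by (auto simp: signing_values_def)
    then have "switch_at v (cnj a) \<tau>' = \<sigma>'"
      unfolding \<tau>' switch_at_def by (auto simp: fun_eq_iff mult.assoc [symmetric])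
    moreover have "cnj a \<in> signing_values"
      using a by (auto simp: signing_values_def)
    ultimately show ?thesis
      by (auto simp: switching_step_def)
  qed
  then have "symp (switching_step :: 'a signing \<Rightarrow> _)"
    by (auto intro: sympI)
  then show ?thesis
    using assms unfolding switching_equivalent_def by (blast dest: symp_rtranclp sympD)
qed

lemma equiv_switching_relation: "equiv (unitary_signings G) (switching_relation G)"
proof (rule equivI)
  show "switching_relation G \<subseteq> unitary_signings G \<times> unitary_signings G"
    by (auto simp: switching_relation_def)
  show "refl_on (unitary_signings G) (switching_relation G)"
    by (auto simp: switching_relation_def refl_on_def switching_equivalent_def)
  show "sym (switching_relation G)"
    by (auto simp: switching_relation_def sym_def intro: switching_equivalent_sym)
  show "trans (switching_relation G)"
    by (auto simp: switching_relation_def trans_def switching_equivalent_def)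
qed

end

theory Submission
  imports Defs
begin

text \<open>
  The Sidon property makes a complex signing of \<open>Q\<^sub>S\<close> unitary iff the two paths
  from \<open>x\<close> to \<open>x + a + b\<close> have opposite values for all distinct \<open>a, b \<in> S\<close>. Hence the ratio of two unitary
  signings is flat, i.e. it agrees on these two paths. Let \<open>B \<subseteq> S\<close> be a basis.
  After switching, a flat ratio is 1 on all edges in the directions of \<open>B\<close>; by flatness it is
  then constant in every direction \<open>s \<in> S\<close>, and being Hermitian, the constant is \<open>1\<close> or \<open>-1\<close>.
  So every class contains a signing obtained from a fixed one by negating the directions in some
  \<open>T \<subseteq> S - B\<close>. A switching between two of these is constant along \<open>B\<close>, hence constant,
  so \<open>T\<close> is unique.
\<close>

section \<open>Vectors over the two-element field\<close>

lemma bit_vec_add_self: "x + x = (0 :: bit ^ 'n)"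
  by (simp add: vec_eq_iff)

lemma bit_vec_add_left_cancel: "x + (x + y) = (y :: bit ^ 'n)"
  by (simp add: bit_vec_add_self flip: add.assoc)

lemma bit_vec_add_eq_iff: "x + y = z \<longleftrightarrow> y = x + (z :: bit ^ 'n)"
  by (metis bit_vec_add_left_cancel)

lemmas bit_vec_simps = bit_vec_add_self bit_vec_add_left_cancel ac_simps

text \<open>Subspaces are closed under differences. This turns the generation hypothesis into linear
  algebra, where bases are available.\<close>

lemma group_closure_subset_span: "group_closure S \<subseteq> vec.span (S :: ('a::field ^ 'n) set)"
proof
  fix x assume "x \<in> group_closure S"
  then show "x \<in> vec.span S"
    by induction (auto intro: vec.span_base vec.span_zero vec.span_diff)
qed

text \<open>The functional is the coordinate at \<open>b\<close> in a basis extending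
  \<open>B\<close>. It will tell apart the two ends of an edge in direction \<open>b\<close> while
  staying constant along the other directions of \<open>B\<close>.\<close>

lemma exists_dual_functional:
  fixes B :: "('a::field ^ 'n) set"
  assumes "vec.independent B" "b \<in> B"
  obtains \<phi> :: "'a ^ 'n \<Rightarrow> 'a" where "\<And>x y. \<phi> (x + y) = \<phi> x + \<phi> y" "\<phi> b = 1"
    "\<And>c. c \<in> B \<Longrightarrow> c \<noteq> b \<Longrightarrow> \<phi> c = 0"
proof
  let ?E = "vec.extend_basis B"
  have E: "vec.independent ?E" "B \<subseteq> ?E" "vec.span ?E = UNIV"
    using assms(1) by (rule vec.independent_extend_basis vec.extend_basis_superset vec.span_extend_basis)+
  let ?\<phi> = "\<lambda>x. vec.representation ?E x b"
  show "?\<phi> (x + y) = ?\<phi> x + ?\<phi> y" for x y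
    using E by (simp add: vec.representation_add)
  show "?\<phi> b = 1"
    using E assms by (simp add: vec.representation_basis subset_iff)
  show "?\<phi> c = 0" if "c \<in> B" "c \<noteq> b" for c
    using E that by (simp add: vec.representation_basis subset_iff)
qed

text \<open>The only scalars are 0 and 1, so every vector is reached from 0 by adding elements of
  \<open>B\<close> one after another.\<close>

lemma constant_if_invariant_under_spanning_set:
  fixes f :: "bit ^ 'n \<Rightarrow> 'a"
  assumes "vec.span B = UNIV" and inv: "\<And>b x. b \<in> B \<Longrightarrow> f (x + b) = f x"
  shows "f x = f 0"
proof -
  have "x \<in> vec.span B" using assms(1) by simp
  then show ?thesis
  proof (induction rule: vec.span_induct_alt)
    case base
    show ?case ..
  next
    case (step c b y)
    then show ?case
      using inv[of b y] by (cases c) (simp_all add: add.commute)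
  qed
qed

section \<open>Switching by a function\<close>

lemma signing_values_cnj: "u \<in> signing_values \<Longrightarrow> cnj u \<in> signing_values"
  by (auto simp: signing_values_def)

lemma signing_values_uminus: "u \<in> signing_values \<Longrightarrow> - u \<in> signing_values"
  by (auto simp: signing_values_def)

lemma signing_values_mult:
  "u \<in> signing_values \<Longrightarrow> v \<in> signing_values \<Longrightarrow> u * v \<in> signing_values"
  by (auto simp: signing_values_def)

lemma signing_values_1: "1 \<in> signing_values"
  by (simp add: signing_values_def)

lemma signing_values_mult_cnj: "u \<in> signing_values \<Longrightarrow> u * cnj u = 1"
  by (auto simp: signing_values_def)

lemma signing_values_cnj_mult: "u \<in> signing_values \<Longrightarrow> cnj u * u = 1"
  by (auto simp: signing_values_def)

lemma signing_values_nonzero: "u \<in> signing_values \<Longrightarrow> u \<noteq> 0"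
  by (auto simp: signing_values_def)

lemma signing_values_real: "u \<in> signing_values \<Longrightarrow> cnj u = u \<Longrightarrow> u = 1 \<or> u = -1"
  by (auto simp: signing_values_def)

text \<open>Simultaneous switching at all vertices, with factor \<open>g v\<close> at
  \<open>v\<close>. On adjacency matrices this is \<open>M\<close> turned into
  \<open>D* M D\<close>, where \<open>D\<close> is the diagonal matrix of \<open>g\<close> and
  \<open>D*\<close> its adjoint.\<close>

definition switch_by :: "('v \<Rightarrow> complex) \<Rightarrow> 'v signing \<Rightarrow> 'v signing" where
  "switch_by g \<sigma> = (\<lambda>x y. cnj (g x) * g y * \<sigma> x y)"

text \<open>At the pair \<open>(v, v)\<close> the two sides carry the different factors
  \<open>a\<close> and \<open>cnj a * a\<close>, which is why the value there has to be 0.\<close>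

lemma switch_at_eq_switch_by:
  assumes "\<sigma> v v = 0"
  shows "switch_at v a \<sigma> = switch_by ((\<lambda>_. 1)(v := a)) \<sigma>"
  using assms by (auto simp: switch_at_def switch_by_def fun_eq_iff)

text \<open>Successive switchings multiply their factors vertex by vertex; conversely, there are
  finitely many vertices, so \<open>g\<close> can be applied at one vertex after another.\<close>

lemma switching_equivalent_iff:
  fixes \<sigma> :: "'v::finite signing"
  assumes loopless: "\<And>v. \<sigma> v v = 0"
  shows "switching_equivalent \<sigma> \<tau> \<longleftrightarrow> (\<exists>g. range g \<subseteq> signing_values \<and> \<tau> = switch_by g \<sigma>)"
proof
  assume "switching_equivalent \<sigma> \<tau>"
  then show "\<exists>g. range g \<subseteq> signing_values \<and> \<tau> = switch_by g \<sigma>"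
    unfolding switching_equivalent_def
  proof induction
    case base
    have "\<sigma> = switch_by (\<lambda>_. 1) \<sigma>" by (simp add: switch_by_def)
    then show ?case by (auto simp: signing_values_1 intro!: exI[of _ "\<lambda>_. 1"])
  next
    case (step \<tau> \<tau>')
    then obtain g v a where g: "range g \<subseteq> signing_values" "\<tau> = switch_by g \<sigma>"
      and a: "a \<in> signing_values" "\<tau>' = switch_at v a \<tau>"
      by (auto simp: switching_step_def)
    have "\<tau> v v = 0" using g loopless by (simp add: switch_by_def)
    then have "\<tau>' = switch_by (\<lambda>x. g x * ((\<lambda>_. 1)(v := a)) x) \<sigma>"
      using a g by (auto simp: switch_at_eq_switch_by switch_by_def fun_eq_iff)
    moreover have "range (\<lambda>x. g x * ((\<lambda>_. 1)(v := a)) x) \<subseteq> signing_values"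
      using g a signing_values_mult by (simp add: image_subset_iff)
    ultimately show ?case by blast
  qed
next
  assume "\<exists>g. range g \<subseteq> signing_values \<and> \<tau> = switch_by g \<sigma>"
  then obtain g where g: "range g \<subseteq> signing_values" and \<tau>: "\<tau> = switch_by g \<sigma>" by blast
  \<comment> \<open>\<open>A\<close> is the set of vertices already treated; all others still have
    factor 1.\<close>
  have "switching_equivalent \<sigma> (switch_by (\<lambda>x. if x \<in> A then g x else 1) \<sigma>)" for A
    using finite[of A]
  proof induction
    case empty
    show ?case by (simp add: switch_by_def switching_equivalent_def)
  next
    case (insert v A)
    let ?\<tau> = "switch_by (\<lambda>x. if x \<in> A then g x else 1) \<sigma>"
    have "?\<tau> v v = 0" using loopless by (simp add: switch_by_def)
    then have "switch_at v (g v) ?\<tau> = switch_by (\<lambda>x. if x \<in> insert v A then g x else 1) \<sigma>"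
      using insert.hyps by (auto simp: switch_at_eq_switch_by switch_by_def fun_eq_iff)
    then have "switching_step ?\<tau> (switch_by (\<lambda>x. if x \<in> insert v A then g x else 1) \<sigma>)"
      unfolding switching_step_def using g by (intro exI[of _ v] bexI[of _ "g v"]) auto
    then show ?case
      using insert.IH by (simp add: switching_equivalent_def rtranclp.rtrancl_into_rtrancl)
  qed
  from this[of UNIV] show "switching_equivalent \<sigma> \<tau>" by (simp add: \<tau>)
qed

section \<open>Unitary signings of Cayley graphs of Sidon sets\<close>

lemma complex_signing_nonedge: "complex_signing G \<sigma> \<Longrightarrow> \<not> G x y \<Longrightarrow> \<sigma> x y = 0"
  unfolding complex_signing_def by blast

lemma complex_signing_value: "complex_signing G \<sigma> \<Longrightarrow> G x y \<Longrightarrow> \<sigma> x y \<in> signing_values"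
  unfolding complex_signing_def by blast

lemma complex_signing_cnj: "complex_signing G \<sigma> \<Longrightarrow> G x y \<Longrightarrow> \<sigma> y x = cnj (\<sigma> x y)"
  unfolding complex_signing_def by blast

lemma cayley_graph_add_iff: "cayley_graph S x (x + s) \<longleftrightarrow> s \<in> S"
  by (simp add: cayley_graph_def bit_vec_add_left_cancel)

lemma cayley_graph_signing_nonedge:
  "complex_signing (cayley_graph S) \<sigma> \<Longrightarrow> x + y \<notin> S \<Longrightarrow> \<sigma> x y = 0"
  using complex_signing_nonedge[of "cayley_graph S" \<sigma> x y] by (simp add: cayley_graph_def)

lemma cayley_graph_signing_value:
  "complex_signing (cayley_graph S) \<sigma> \<Longrightarrow> s \<in> S \<Longrightarrow> \<sigma> x (x + s) \<in> signing_values"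
  using complex_signing_value[of "cayley_graph S" \<sigma> x "x + s"] by (simp add: cayley_graph_add_iff)

lemma cayley_graph_signing_cnj:
  "complex_signing (cayley_graph S) \<sigma> \<Longrightarrow> s \<in> S \<Longrightarrow> \<sigma> (x + s) x = cnj (\<sigma> x (x + s))"
  using complex_signing_cnj[of "cayley_graph S" \<sigma> x "x + s"] by (simp add: cayley_graph_add_iff)

lemma card_cayley_neighbours: "card {y. cayley_graph S x y} = card S"
proof -
  have "{y. cayley_graph S x y} = (+) x ` S"
  proof (intro equalityI subsetI)
    fix y assume "y \<in> {y. cayley_graph S x y}"
    then show "y \<in> (+) x ` S"
      by (intro image_eqI[of _ _ "x + y"]) (simp_all add: cayley_graph_def bit_vec_add_left_cancel)
  qed (auto simp: cayley_graph_def bit_vec_add_left_cancel)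
  then show ?thesis by (simp add: card_image)
qed

lemma signed_adjacency_matrix_square_entry:
  "(signed_adjacency_matrix \<sigma> ** signed_adjacency_matrix \<sigma>) $ x $ y = (\<Sum>z\<in>UNIV. \<sigma> x z * \<sigma> z y)"
  by (simp add: signed_adjacency_matrix_def matrix_matrix_mult_def)

text \<open>A nonzero summand at \<open>z\<close> writes \<open>a + b\<close> as the sum of the two
  elements \<open>x + z\<close> and \<open>z + (x + a + b)\<close> of \<open>S\<close>. By the Sidon
  property these are \<open>a\<close> and \<open>b\<close> in some order, so \<open>z\<close> is
  \<open>x + a\<close> or \<open>x + b\<close>.\<close>

lemma sidon_two_path_sum:
  assumes "sidon_set S" "complex_signing (cayley_graph S) \<sigma>" "a \<in> S" "b \<in> S" "a \<noteq> b"
  shows "(\<Sum>z\<in>UNIV. \<sigma> x z * \<sigma> z (x + a + b)) =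
    \<sigma> x (x + a) * \<sigma> (x + a) (x + a + b) + \<sigma> x (x + b) * \<sigma> (x + b) (x + a + b)"
proof -
  have "\<sigma> x z * \<sigma> z (x + a + b) = 0" if z: "z \<notin> {x + a, x + b}" for z
  proof (rule ccontr)
    assume "\<not> ?thesis"
    then have e: "x + z \<in> S" "z + (x + a + b) \<in> S"
      using cayley_graph_signing_nonedge[OF assms(2)] by force+
    have eq: "a + b = (x + z) + (z + (x + a + b))" by (simp add: bit_vec_simps)
    \<comment> \<open>The Sidon property speaks of distinct summands only; equal ones would have sum
      0 and force \<open>a = b\<close>.\<close>
    have "x + z \<noteq> z + (x + a + b)"
    proof
      assume "x + z = z + (x + a + b)"
      then have "a + b = 0" using eq by (metis bit_vec_add_self)
      then show False using \<open>a \<noteq> b\<close> by (simp add: bit_vec_add_eq_iff)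
    qed
    then have "{a, b} = {x + z, z + (x + a + b)}"
      using assms(1,3-5) e eq unfolding sidon_set_def by blast
    then have "x + z \<in> {a, b}" by blast
    then show False using z by (auto simp: bit_vec_add_eq_iff)
  qed
  then have "(\<Sum>z\<in>UNIV. \<sigma> x z * \<sigma> z (x + a + b)) = (\<Sum>z\<in>{x + a, x + b}. \<sigma> x z * \<sigma> z (x + a + b))"
    by (intro sum.mono_neutral_right) auto
  then show ?thesis using assms(5) by simp
qed

text \<open>The diagonal of the squared matrix is \<open>card S\<close> for every complex signing,
  because each edge contributes a value times its conjugate. An entry off the diagonal either has no
  two-edge path or consists of the two paths around one square.\<close>

lemma unitary_signing_cayley_iff:
  assumes sidon: "sidon_set S"
  shows "unitary_signing (cayley_graph S) \<sigma> \<longleftrightarrow> complex_signing (cayley_graph S) \<sigma> \<and>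
    (\<forall>x. \<forall>a\<in>S. \<forall>b\<in>S. a \<noteq> b \<longrightarrow>
      \<sigma> x (x + a) * \<sigma> (x + a) (x + a + b) + \<sigma> x (x + b) * \<sigma> (x + b) (x + a + b) = 0)"
    (is "_ \<longleftrightarrow> _ \<and> ?squares")
proof
  assume u: "unitary_signing (cayley_graph S) \<sigma>"
  then have c: "complex_signing (cayley_graph S) \<sigma>" by (simp add: unitary_signing_def)
  obtain d where d: "signed_adjacency_matrix \<sigma> ** signed_adjacency_matrix \<sigma> = mat (of_nat d)"
    using u by (auto simp: unitary_signing_def)
  have ?squares
  proof (intro allI ballI impI)
    fix x a b assume ab: "a \<in> S" "b \<in> S" "a \<noteq> b"
    then have "x \<noteq> x + a + b"
      using bit_vec_add_eq_iff[of a b 0] by (auto simp: add.assoc)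
    then have "(\<Sum>z\<in>UNIV. \<sigma> x z * \<sigma> z (x + a + b)) = 0"
      using d by (simp flip: signed_adjacency_matrix_square_entry add: mat_def)
    then show "\<sigma> x (x + a) * \<sigma> (x + a) (x + a + b) + \<sigma> x (x + b) * \<sigma> (x + b) (x + a + b) = 0"
      using sidon_two_path_sum[OF sidon c ab] by simp
  qed
  with c show "complex_signing (cayley_graph S) \<sigma> \<and> ?squares" by simp
next
  assume "complex_signing (cayley_graph S) \<sigma> \<and> ?squares"
  then have c: "complex_signing (cayley_graph S) \<sigma>" and sq: ?squares by simp_all
  have "(\<Sum>z\<in>UNIV. \<sigma> x z * \<sigma> z y) = (if x = y then of_nat (card S) else 0)" for x y
  proof (cases "x = y")
    case True
    have "\<sigma> x z * \<sigma> z x = (if z \<in> {z. cayley_graph S x z} then 1 else 0)" for z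
      using signing_values_mult_cnj[OF complex_signing_value[OF c, of x z]]
        complex_signing_cnj[OF c, of x z] complex_signing_nonedge[OF c, of x z] by auto
    then show ?thesis
      using True by (simp add: sum.If_cases card_cayley_neighbours)
  next
    case False
    show ?thesis
    proof (cases "\<exists>a\<in>S. \<exists>b\<in>S. y = x + a + b")
      case True
      then obtain a b where ab: "a \<in> S" "b \<in> S" "y = x + a + b" by blast
      then have "a \<noteq> b" using \<open>x \<noteq> y\<close> by (auto simp: bit_vec_simps)
      then show ?thesis
        using sidon_two_path_sum[OF sidon c ab(1,2)] sq ab False by simp
    next
      case none: False
      have "\<sigma> x z * \<sigma> z y = 0" for z
      proof (rule ccontr)
        assume "\<not> ?thesis"
        then have "x + z \<in> S" "z + y \<in> S"
          using cayley_graph_signing_nonedge[OF c] by force+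
        moreover have "y = x + (x + z) + (z + y)" by (simp add: bit_vec_simps)
        ultimately show False using none by blast
      qed
      then show ?thesis using False by (simp add: sum.neutral)
    qed
  qed
  then have "signed_adjacency_matrix \<sigma> ** signed_adjacency_matrix \<sigma> = mat (of_nat (card S))"
    by (simp add: vec_eq_iff signed_adjacency_matrix_square_entry mat_def)
  then show "unitary_signing (cayley_graph S) \<sigma>"
    using c by (auto simp: unitary_signing_def regular_graph_def card_cayley_neighbours)
qed

section \<open>Flat ratios\<close>

text \<open>Here \<open>h b x\<close> is the value on the edge from \<open>x\<close> to
  \<open>x + b\<close>. The edges in independent directions form disjoint cubes, whose cycles are
  generated by squares, so flat values come from a function on the vertices. The induction adds one
  direction \<open>b\<close> at a time and corrects \<open>g\<close> by a factor invariant along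
  \<open>A\<close>.\<close>

lemma flat_gauge_on_independent:
  fixes B :: "(bit ^ 'n) set"
  assumes indep: "vec.independent B" and "A \<subseteq> B"
    and val: "\<And>b x. b \<in> B \<Longrightarrow> h b x \<in> signing_values"
    and herm: "\<And>b x. b \<in> B \<Longrightarrow> h b (x + b) = cnj (h b x)"
    and flat: "\<And>b c x. b \<in> B \<Longrightarrow> c \<in> B \<Longrightarrow> h b x * h c (x + b) = h c x * h b (x + c)"
  shows "\<exists>g. range g \<subseteq> signing_values \<and> (\<forall>a\<in>A. \<forall>x. h a x = cnj (g x) * g (x + a))"
  using finite[of A] \<open>A \<subseteq> B\<close>
proof (induction A)
  case empty
  show ?case by (auto intro: exI[of _ "\<lambda>_. 1"] simp: signing_values_1)
next
  case (insert b A)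
  then obtain g where g: "\<And>x. g x \<in> signing_values"
    and gA: "\<And>a x. a \<in> A \<Longrightarrow> h a x = cnj (g x) * g (x + a)" by blast
  have b: "b \<in> B" using insert.prems by simp
  obtain \<phi> :: "bit ^ 'n \<Rightarrow> bit" where \<phi>: "\<And>x y. \<phi> (x + y) = \<phi> x + \<phi> y" "\<phi> b = 1"
    and \<phi>0: "\<And>c. c \<in> B \<Longrightarrow> c \<noteq> b \<Longrightarrow> \<phi> c = 0"
    by (rule exists_dual_functional[OF indep b]) blast
  note unit = signing_values_mult_cnj[OF g] signing_values_cnj_mult[OF g]
  \<comment> \<open>The values in direction \<open>b\<close> that remain once \<open>g\<close> is
    divided out.\<close>
  define h' where "h' x = g x * h b x * cnj (g (x + b))" for x
  have h'_val: "h' x \<in> signing_values" for x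
    unfolding h'_def using b by (intro signing_values_mult signing_values_cnj g val)
  have h'_herm: "h' (x + b) = cnj (h' x)" for x
    using herm[OF b, of x] by (simp add: h'_def add.assoc bit_vec_add_self)
  \<comment> \<open>Flatness on the square in directions \<open>a\<close> and \<open>b\<close>: its
    edges in direction \<open>a\<close> become 1 after dividing by \<open>g\<close>, so its two
    edges in direction \<open>b\<close> carry equal values.\<close>
  have h'_inv: "h' (x + a) = h' x" if a: "a \<in> A" for a x
  proof -
    have aB: "a \<in> B" using a insert.prems by blast
    have eq: "h b x * (cnj (g (x + b)) * g (x + b + a)) = cnj (g x) * g (x + a) * h b (x + a)"
      using flat[OF b aB, of x] gA[OF a] by simp
    have "h' x = g x * (h b x * (cnj (g (x + b)) * g (x + b + a))) * cnj (g (x + b + a))"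
      using unit[of "x + b + a"] by (simp add: h'_def mult.assoc)
    also have "\<dots> = (g x * cnj (g x)) * g (x + a) * h b (x + a) * cnj (g (x + b + a))"
      unfolding eq by (simp add: mult.assoc)
    also have "\<dots> = h' (x + a)"
      by (simp add: unit h'_def ac_simps)
    finally show ?thesis by simp
  qed
  \<comment> \<open>Every edge in direction \<open>b\<close> has exactly one end with
    \<open>\<phi> = 0\<close>, and the whole value is placed there. The conjugate fits the
    convention of \<open>switch_by\<close>, and the reversed edge is covered by
    \<open>h'_herm\<close>.\<close>
  define k where "k x = (if \<phi> x = 0 then cnj (h' x) else 1)" for x
  have k_val: "k x \<in> signing_values" for x
    by (simp add: k_def h'_val signing_values_cnj signing_values_1)
  have k_b: "h' x = cnj (k x) * k (x + b)" for x
    by (cases "\<phi> x") (simp_all add: k_def \<phi> h'_herm)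
  have k_A: "k (x + a) = k x" if "a \<in> A" for a x
  proof -
    have "\<phi> a = 0" using \<phi>0 that insert by blast
    then show ?thesis using that by (simp add: k_def \<phi> h'_inv)
  qed
  have "h a x = cnj (g x * k x) * (g (x + a) * k (x + a))" if "a \<in> insert b A" for a x
  proof (cases "a = b")
    case True
    have "h b x = (cnj (g x) * g x) * h b x * (cnj (g (x + b)) * g (x + b))"
      by (simp only: unit) simp
    also have "\<dots> = cnj (g x) * h' x * g (x + b)" by (simp add: h'_def ac_simps)
    finally show ?thesis using True by (simp add: k_b ac_simps)
  next
    case False
    then have a: "a \<in> A" using that by simp
    have "cnj (g x * k x) * (g (x + a) * k (x + a)) = cnj (g x) * g (x + a) * (cnj (k x) * k x)"
      by (simp add: k_A[OF a])
    then show ?thesis by (simp add: gA[OF a] signing_values_cnj_mult[OF k_val])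
  qed
  moreover have "range (\<lambda>x. g x * k x) \<subseteq> signing_values"
    using g k_val by (auto intro: signing_values_mult)
  ultimately show ?case by blast
qed

text \<open>The function \<open>g\<close> is fixed by the directions of the basis \<open>B\<close>
  alone. What is left in any direction of \<open>S\<close> is a single sign, and \<open>T\<close>
  collects the directions with sign -1; it avoids \<open>B\<close>, where the remaining value is
  1.\<close>

lemma flat_eq_gauge_times_sign:
  fixes S :: "(bit ^ 'n) set"
  assumes indep: "vec.independent B" and "B \<subseteq> S" and span: "vec.span B = UNIV"
    and val: "\<And>s x. s \<in> S \<Longrightarrow> h s x \<in> signing_values"
    and herm: "\<And>s x. s \<in> S \<Longrightarrow> h s (x + s) = cnj (h s x)"
    and flat: "\<And>s t x. s \<in> S \<Longrightarrow> t \<in> S \<Longrightarrow> h s x * h t (x + s) = h t x * h s (x + t)"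
  obtains g T where "range g \<subseteq> signing_values" "T \<subseteq> S - B"
    "\<And>s x. s \<in> S \<Longrightarrow> h s x = cnj (g x) * g (x + s) * (if s \<in> T then -1 else 1)"
proof -
  have "\<exists>g. range g \<subseteq> signing_values \<and> (\<forall>b\<in>B. \<forall>x. h b x = cnj (g x) * g (x + b))"
    by (rule flat_gauge_on_independent[OF indep order.refl]) (use \<open>B \<subseteq> S\<close> val herm flat in blast)+
  then obtain g where g: "\<And>x. g x \<in> signing_values"
    and gB: "\<And>b x. b \<in> B \<Longrightarrow> h b x = cnj (g x) * g (x + b)" by blast
  note unit = signing_values_mult_cnj[OF g] signing_values_cnj_mult[OF g]
  define k where "k s x = g x * h s x * cnj (g (x + s))" for s x
  have h_k: "h s x = cnj (g x) * g (x + s) * k s x" for s x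
  proof -
    have "cnj (g x) * g (x + s) * k s x
      = (cnj (g x) * g x) * (g (x + s) * cnj (g (x + s))) * h s x"
      by (simp add: k_def ac_simps)
    then show ?thesis by (simp add: unit)
  qed
  \<comment> \<open>Flatness on the square in directions \<open>s\<close> and \<open>b\<close>,
    where dividing by \<open>g\<close> makes the edges in direction \<open>b\<close> equal to
    1.\<close>
  have k_inv: "k s (x + b) = k s x" if s: "s \<in> S" and b: "b \<in> B" for s b x
  proof -
    have eq: "h s x * (cnj (g (x + s)) * g (x + s + b)) = cnj (g x) * g (x + b) * h s (x + b)"
      using flat[of s b x] \<open>B \<subseteq> S\<close> s b gB[OF b] by auto
    have "k s x = g x * (h s x * (cnj (g (x + s)) * g (x + s + b))) * cnj (g (x + s + b))"
      using unit[of "x + s + b"] by (simp add: k_def mult.assoc)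
    also have "\<dots> = (g x * cnj (g x)) * g (x + b) * h s (x + b) * cnj (g (x + s + b))"
      unfolding eq by (simp add: mult.assoc)
    also have "\<dots> = k s (x + b)"
      by (simp add: unit k_def ac_simps)
    finally show ?thesis by simp
  qed
  have k_const: "k s x = k s 0" if "s \<in> S" for s x
    using constant_if_invariant_under_spanning_set[OF span, of "k s"] k_inv[OF that] by blast
  have k_real: "k s 0 = 1 \<or> k s 0 = -1" if s: "s \<in> S" for s
  proof (rule signing_values_real)
    show "k s 0 \<in> signing_values"
      unfolding k_def using s by (intro signing_values_mult signing_values_cnj g val)
    \<comment> \<open>The two orientations of an edge have conjugate values, but both equal the
      constant of direction \<open>s\<close>; hence it is real.\<close>
    have "k s (0 + s) = cnj (k s 0)"
      unfolding k_def using herm[OF s, of 0] by (simp add: bit_vec_simps)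
    then show "cnj (k s 0) = k s 0" using k_const[OF s, of "0 + s"] by simp
  qed
  have k_B: "k b 0 = 1" if "b \<in> B" for b
    using gB[OF that, of 0] unit[of 0] unit[of b] by (simp add: k_def mult.assoc[symmetric])
  show thesis
  proof
    show "range g \<subseteq> signing_values" using g by blast
    show "{s \<in> S. k s 0 = -1} \<subseteq> S - B"
    proof
      fix s assume "s \<in> {s \<in> S. k s 0 = -1}"
      then show "s \<in> S - B" using k_B[of s] by auto
    qed
    show "h s x = cnj (g x) * g (x + s) * (if s \<in> {s \<in> S. k s 0 = -1} then -1 else 1)"
      if "s \<in> S" for s x
      using h_k[of s x] k_const[OF that, of x] k_real[OF that] that by auto
  qed
qed

section \<open>Negating directions\<close>

text \<open>With \<open>T\<close> running over the subsets of \<open>S - B\<close>, these signings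
  will represent the classes.\<close>

definition negate_directions :: "(bit ^ 'n) set \<Rightarrow> (bit ^ 'n) signing \<Rightarrow> (bit ^ 'n) signing" where
  "negate_directions T \<sigma> = (\<lambda>x y. (if x + y \<in> T then -1 else 1) * \<sigma> x y)"

text \<open>Both paths around a square use one edge in direction \<open>a\<close> and one in
  direction \<open>b\<close>, so they change by the same sign and their sum remains 0.\<close>

lemma unitary_signing_negate_directions:
  assumes sidon: "sidon_set S" and u: "unitary_signing (cayley_graph S) \<sigma>"
  shows "unitary_signing (cayley_graph S) (negate_directions T \<sigma>)"
proof -
  let ?\<tau> = "negate_directions T \<sigma>"
  note iff = unitary_signing_cayley_iff[OF sidon]
  from u have c: "complex_signing (cayley_graph S) \<sigma>"
    and sq: "\<And>x a b. a \<in> S \<Longrightarrow> b \<in> S \<Longrightarrow> a \<noteq> b \<Longrightarrow>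
      \<sigma> x (x + a) * \<sigma> (x + a) (x + a + b) + \<sigma> x (x + b) * \<sigma> (x + b) (x + a + b) = 0"
    unfolding iff by blast+
  have "complex_signing (cayley_graph S) ?\<tau>"
    unfolding complex_signing_def negate_directions_def
    using complex_signing_value[OF c] complex_signing_cnj[OF c] complex_signing_nonedge[OF c]
    by (simp add: add.commute signing_values_uminus)
  moreover have "?\<tau> x (x + a) * ?\<tau> (x + a) (x + a + b) + ?\<tau> x (x + b) * ?\<tau> (x + b) (x + a + b) = 0"
    if "a \<in> S" "b \<in> S" "a \<noteq> b" for x a b
  proof -
    have eqs: "x + (x + a) = a" "x + (x + b) = b" "x + a + (x + a + b) = b" "x + b + (x + a + b) = a"
      by (simp_all add: bit_vec_simps)
    have "?\<tau> x (x + a) * ?\<tau> (x + a) (x + a + b) + ?\<tau> x (x + b) * ?\<tau> (x + b) (x + a + b)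
      = (if a \<in> T then -1 else 1) * (if b \<in> T then -1 else 1) *
        (\<sigma> x (x + a) * \<sigma> (x + a) (x + a + b) + \<sigma> x (x + b) * \<sigma> (x + b) (x + a + b))"
      unfolding negate_directions_def eqs by (simp add: algebra_simps)
    then show ?thesis by (simp add: sq[OF that])
  qed
  ultimately show ?thesis unfolding iff by blast
qed

text \<open>Existence of a representative: the ratio of two unitary signings is flat, and its normal
  form as vertex factors times signs gives both the switching and \<open>T\<close>.\<close>

lemma unitary_signing_switching_equivalent_negate_directions:
  assumes sidon: "sidon_set S" and S0: "0 \<notin> S"
    and B: "vec.independent B" "B \<subseteq> S" "vec.span B = UNIV"
    and \<sigma>: "unitary_signing (cayley_graph S) \<sigma>" and \<tau>: "unitary_signing (cayley_graph S) \<tau>"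
  obtains T where "T \<subseteq> S - B" "switching_equivalent (negate_directions T \<sigma>) \<tau>"
proof -
  note iff = unitary_signing_cayley_iff[OF sidon]
  have sq: "\<rho> x (x + a) * \<rho> (x + a) (x + a + b) = - (\<rho> x (x + b) * \<rho> (x + b) (x + b + a))"
    if "unitary_signing (cayley_graph S) \<rho>" "a \<in> S" "b \<in> S" "a \<noteq> b" for \<rho> x a b
  proof -
    have "\<rho> x (x + a) * \<rho> (x + a) (x + a + b) + \<rho> x (x + b) * \<rho> (x + b) (x + a + b) = 0"
      using that iff by blast
    moreover have eq: "x + b + a = x + a + b" by (simp add: ac_simps)
    ultimately show ?thesis unfolding eq eq_neg_iff_add_eq_0 by simp
  qed
  have c\<sigma>: "complex_signing (cayley_graph S) \<sigma>" and c\<tau>: "complex_signing (cayley_graph S) \<tau>"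
    using \<sigma> \<tau> unfolding iff by blast+
  \<comment> \<open>The ratio of \<open>\<tau>\<close> to \<open>\<sigma>\<close> on an edge, since
    values of \<open>\<sigma>\<close> on edges have their conjugates as inverses.\<close>
  define h where "h s x = \<tau> x (x + s) * cnj (\<sigma> x (x + s))" for s x
  have h_val: "h s x \<in> signing_values" if "s \<in> S" for s x
    unfolding h_def using that c\<sigma> c\<tau>
    by (intro signing_values_mult signing_values_cnj cayley_graph_signing_value)
  have h_herm: "h s (x + s) = cnj (h s x)" if "s \<in> S" for s x
  proof -
    have "x + s + s = x" by (simp add: add.assoc bit_vec_add_self)
    then show ?thesis
      using cayley_graph_signing_cnj[OF c\<sigma> that, of x] cayley_graph_signing_cnj[OF c\<tau> that, of x]
      by (simp add: h_def)
  qed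
  \<comment> \<open>Exchanging the two paths of a square costs a minus sign in
    \<open>\<sigma>\<close> and another in \<open>\<tau>\<close>; the two cancel in the
    ratio.\<close>
  have h_flat: "h s x * h t (x + s) = h t x * h s (x + t)" if "s \<in> S" "t \<in> S" for s t x
  proof (cases "s = t")
    case False
    have "h s x * h t (x + s) = (\<tau> x (x + s) * \<tau> (x + s) (x + s + t)) *
        cnj (\<sigma> x (x + s) * \<sigma> (x + s) (x + s + t))"
      by (simp add: h_def)
    also have "\<dots> = (\<tau> x (x + t) * \<tau> (x + t) (x + t + s)) *
        cnj (\<sigma> x (x + t) * \<sigma> (x + t) (x + t + s))"
      unfolding sq[OF \<sigma> that False] sq[OF \<tau> that False] by simp
    also have "\<dots> = h t x * h s (x + t)"
      by (simp add: h_def)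
    finally show ?thesis .
  qed simp
  obtain g T where g: "range g \<subseteq> signing_values" and T: "T \<subseteq> S - B"
    and h: "\<And>s x. s \<in> S \<Longrightarrow> h s x = cnj (g x) * g (x + s) * (if s \<in> T then -1 else 1)"
    using flat_eq_gauge_times_sign[of B S h, OF B h_val h_herm h_flat] by blast
  have "\<tau> x y = switch_by g (negate_directions T \<sigma>) x y" for x y
  proof (cases "x + y \<in> S")
    case True
    have y: "x + (x + y) = y" by (simp add: bit_vec_simps)
    have "\<tau> x y = h (x + y) x * \<sigma> x y"
      using signing_values_cnj_mult[OF cayley_graph_signing_value[OF c\<sigma> True, of x]]
      by (simp add: h_def y mult.assoc)
    then show ?thesis
      by (simp add: h[OF True] y switch_by_def negate_directions_def)
  next
    case False
    then show ?thesis
      using cayley_graph_signing_nonedge[OF c\<sigma> False] cayley_graph_signing_nonedge[OF c\<tau> False]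
      by (simp add: switch_by_def negate_directions_def)
  qed
  then have "\<tau> = switch_by g (negate_directions T \<sigma>)" by blast
  moreover have "negate_directions T \<sigma> v v = 0" for v
    using cayley_graph_signing_nonedge[OF c\<sigma>, of v v] S0
    by (simp add: negate_directions_def bit_vec_add_self)
  ultimately have "switching_equivalent (negate_directions T \<sigma>) \<tau>"
    using g by (subst switching_equivalent_iff) auto
  then show thesis using T that by blast
qed

text \<open>Uniqueness of the representative: both signings agree with \<open>\<sigma>\<close> in
  the directions of \<open>B\<close>, so the switching function is invariant along \<open>B\<close>,
  hence constant. A constant function switches nothing, so the signs agree in all
  directions.\<close>

lemma negate_directions_switching_equivalent_imp_eq:
  assumes c: "complex_signing (cayley_graph S) \<sigma>" and S0: "0 \<notin> S"
    and B: "B \<subseteq> S" "vec.span B = UNIV"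
    and T: "T \<subseteq> S - B" "T' \<subseteq> S - B"
    and eqv: "switching_equivalent (negate_directions T \<sigma>) (negate_directions T' \<sigma>)"
  shows "T = T'"
proof -
  have loopless: "negate_directions T \<sigma> v v = 0" for v
    using cayley_graph_signing_nonedge[OF c, of v v] S0
    by (simp add: negate_directions_def bit_vec_add_self)
  obtain g where g: "\<And>x. g x \<in> signing_values"
    and eq: "negate_directions T' \<sigma> = switch_by g (negate_directions T \<sigma>)"
    using eqv switching_equivalent_iff[of "negate_directions T \<sigma>", OF loopless] by blast
  \<comment> \<open>The values of \<open>\<sigma>\<close> on edges are nonzero and cancel, leaving a
    relation between signs and \<open>g\<close> only.\<close>
  have ratio: "(if s \<in> T' then -1 else 1) = cnj (g x) * g (x + s) * (if s \<in> T then -1 else 1)"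
    if "s \<in> S" for s x
  proof -
    have "(if s \<in> T' then -1 else 1) * \<sigma> x (x + s)
      = cnj (g x) * g (x + s) * (if s \<in> T then -1 else 1) * \<sigma> x (x + s)"
      using fun_cong[OF fun_cong[OF eq, of x], of "x + s"]
      by (simp only: negate_directions_def switch_by_def bit_vec_add_left_cancel mult.assoc)
    then show ?thesis
      using mult_right_cancel[OF signing_values_nonzero[OF cayley_graph_signing_value[OF c that, of x]]]
      by blast
  qed
  have "g (x + b) = g x" if "b \<in> B" for b x
  proof -
    have "b \<in> S" "b \<notin> T" "b \<notin> T'" using that B(1) T by blast+
    then have "cnj (g x) * g (x + b) = 1" using ratio[of b x] by simp
    then have "g x * (cnj (g x) * g (x + b)) = g x" by simp
    then show ?thesis by (simp add: signing_values_mult_cnj[OF g] flip: mult.assoc)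
  qed
  then have const: "g x = g 0" for x
    using constant_if_invariant_under_spanning_set[OF B(2)] by blast
  have "s \<in> T \<longleftrightarrow> s \<in> T'" if "s \<in> S" for s
  proof -
    have "cnj (g 0) * g (0 + s) = 1"
      using const[of s] signing_values_cnj_mult[OF g, of 0] by simp
    then show ?thesis using ratio[OF that, of 0] by (simp split: if_splits)
  qed
  then show ?thesis using T by blast
qed

section \<open>Counting the switching classes\<close>

theorem corollary4p8:
  fixes S :: "(bit ^ 'n) set"
  assumes "sidon_set S"
    and "0 \<notin> S"
    and "group_closure S = UNIV"
    and "\<exists>\<sigma>. unitary_signing (cayley_graph S) \<sigma>"
  shows "card (unitary_signings (cayley_graph S) // switching_relation (cayley_graph S))
           = 2 ^ (card S - CARD('n))"
proof -
  let ?U = "unitary_signings (cayley_graph S)" and ?R = "switching_relation (cayley_graph S)"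
  obtain \<sigma> where \<sigma>: "unitary_signing (cayley_graph S) \<sigma>" using assms(4) by blast
  then have c: "complex_signing (cayley_graph S) \<sigma>" by (simp add: unitary_signing_def)
  have span_S: "vec.span S = UNIV"
    using group_closure_subset_span[of S] assms(3) by blast
  \<comment> \<open>The basis is taken inside \<open>S\<close>, so that its elements are directions
    of edges.\<close>
  obtain B where B: "B \<subseteq> S" "vec.independent B" "S \<subseteq> vec.span B" "card B = vec.dim S"
    using vec.basis_exists by blast
  have span_B: "vec.span B = UNIV"
    using vec.span_mono[OF B(3)] span_S by (simp add: vec.span_span top.extremum_unique)
  have card_B: "card B = CARD('n)"
    using B(4) vec.dim_span[of S] span_S vec_dim_card[where 'a=bit and 'n='n] by simp
  let ?f = "\<lambda>T. ?R `` {negate_directions T \<sigma>}"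
  have inU: "negate_directions T \<sigma> \<in> ?U" for T
    using unitary_signing_negate_directions[OF assms(1) \<sigma>] by (simp add: unitary_signings_def)
  \<comment> \<open>Injectivity is the uniqueness of \<open>T\<close>, surjectivity the existence of
    a representative in each class.\<close>
  have "bij_betw ?f (Pow (S - B)) (?U // ?R)"
  proof (intro bij_betw_imageI inj_onI)
    fix T T' assume T: "T \<in> Pow (S - B)" "T' \<in> Pow (S - B)" and "?f T = ?f T'"
    then have "switching_equivalent (negate_directions T \<sigma>) (negate_directions T' \<sigma>)"
      unfolding eq_equiv_class_iff[OF equiv_switching_relation inU inU]
      by (simp add: switching_relation_def)
    then show "T = T'"
      using negate_directions_switching_equivalent_imp_eq[OF c assms(2) B(1) span_B] T by blast
  next
    show "?f ` Pow (S - B) = ?U // ?R"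
    proof
      show "?f ` Pow (S - B) \<subseteq> ?U // ?R" using inU by (intro image_subsetI quotientI)
      show "?U // ?R \<subseteq> ?f ` Pow (S - B)"
      proof
        fix X assume "X \<in> ?U // ?R"
        then obtain \<tau> where \<tau>: "\<tau> \<in> ?U" "X = ?R `` {\<tau>}" by (rule quotientE)
        then obtain T where T: "T \<subseteq> S - B" "switching_equivalent (negate_directions T \<sigma>) \<tau>"
          using unitary_signing_switching_equivalent_negate_directions
            [OF assms(1,2) B(2,1) span_B \<sigma>, of \<tau>] by (simp add: unitary_signings_def) blast
        then have "(negate_directions T \<sigma>, \<tau>) \<in> ?R"
          using inU \<tau>(1) by (simp add: switching_relation_def)
        then have "X = ?f T"
          using \<tau>(2) equiv_class_eq[OF equiv_switching_relation] by metis
        then show "X \<in> ?f ` Pow (S - B)" using T by blast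
      qed
    qed
  qed
  then have "card (?U // ?R) = card (Pow (S - B))" by (simp add: bij_betw_same_card)
  \<comment> \<open>As \<open>B\<close> lies in \<open>S\<close> and has \<open>CARD('n)\<close>
    elements, the subtraction of natural numbers in the exponent is not truncated.\<close>
  then show ?thesis using B(1) card_B by (simp add: card_Pow card_Diff_subset)
qed

end
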